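(* Let $\mathcal C$ be a class of graphs with universally bounded merge-width. Then there is a class $\mathcal D$ of graphs of bounded expansion such that every $G\in\mathcal C$ is $(13,12)$-quasi-isometric to some $H\in\mathcal D$.
   Context: Graphs are finite, simple, undirected. For a partition $\mathcal P$ of $V(G)$ and $X\subseteq V(G)$, $X/\mathcal P$ is the set of parts intersecting $X$. For $R\subseteq\binom{V(G)}2$, $\mathrm{Ball}^r_R(v)$ is the radius-$r$ ball in $(V(G),R)$. $\mathcal P$ is homogeneous modulo $R$ if for all parts $X,Y$ (possibly equal), the pairs $\{x,y\}$, $x\in X,y\in Y,x\neq y$, not in $R$ are all edges of $G$ or all non-edges. A merge sequence for $G$ is $(\mathcal P_1,R_1),\dots,(\mathcal P_m,R_m)$ with $\mathcal P_1\preceq\dots\preceq\mathcal P_m$ partitions of $V(G)$, $\mathcal P_1$ into singletons, $\mathcal P_m=\{V(G)\}$, $R_1\subseteq\dots\subseteq R_m$, $\mathcal P_t$ homogeneous modulo $R_t$; its radius-$r$ width is $\max_{t<m}\max_v|\mathrm{Ball}^r_{R_{t+1}}(v)/\mathcal P_t|$. A class $\mathcal C$ has universally bounded merge-width if there is $f:\mathbb N\to\mathbb N$ such that every $G\in\mathcal C$ has a single merge sequence whose radius-$r$ width is at most $f(r)$ for every $r\in\mathbb N$. For a total order $<$ on $V(H)$, $u$ is strongly $r$-reachable from $v\ge u$ if there is a path of length at most $r$ from $v$ to $u$ all of whose internal vertices $w$ satisfy $w>v$; $\mathrm{scol}_r(H)$ is the minimum over orders of the maximum over $v$ of the number of vertices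 strongly $r$-reachable from $v$. A class $\mathcal D$ has bounded expansion iff $\sup_{H\in\mathcal D}\mathrm{scol}_r(H)<\infty$ for every $r$. A map $\phi:V(G)\to V(H)$ is an $(a,b)$-quasi-isometry if $\frac1a\mathrm{dist}_G(x,x')-b\le\mathrm{dist}_H(\phi(x),\phi(x'))\le a\,\mathrm{dist}_G(x,x')+b$ for all $x,x'$, and every $y\in V(H)$ has some $x$ with $\mathrm{dist}_H(y,\phi(x))\le b$; $G$ is $(a,b)$-quasi-isometric to $H$ if such a map exists. *)

theory Defs
  imports Complex_Main "HOL-Library.Extended_Real" "HOL-Library.Disjoint_Sets" "HOL-Library.Ramsey"
begin

type_synonym 'a ugraph = "'a set \<times> 'a set set"

abbreviation uverts :: "'a ugraph \<Rightarrow> 'a set" where "uverts \<equiv> fst"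
abbreviation uedges :: "'a ugraph \<Rightarrow> 'a set set" where "uedges \<equiv> snd"

definition simple_graph :: "'a ugraph \<Rightarrow> bool" where
  "simple_graph G \<longleftrightarrow> finite (uverts G) \<and> uedges G \<subseteq> nsets (uverts G) 2"

text \<open>Paths are given by their lists of vertices; the length of the path \<open>p\<close> is \<open>length p - 1\<close>.\<close>

definition upath :: "'a ugraph \<Rightarrow> 'a \<Rightarrow> 'a list \<Rightarrow> 'a \<Rightarrow> bool" where
  "upath G u p v \<longleftrightarrow>
     p \<noteq> [] \<and> hd p = u \<and> last p = v \<and> distinct p \<and> set p \<subseteq> uverts G \<and>
     (\<forall>i. Suc i < length p \<longrightarrow> {p ! i, p ! Suc i} \<in> uedges G)"

text \<open>The distance is \<open>\<infinity>\<close> between different connected components.\<close>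

definition udist :: "'a ugraph \<Rightarrow> 'a \<Rightarrow> 'a \<Rightarrow> enat" where
  "udist G u v = (INF p \<in> {p. upath G u p v}. enat (length p - 1))"

definition uball :: "'a ugraph \<Rightarrow> nat \<Rightarrow> 'a \<Rightarrow> 'a set" where
  "uball G r v = {u \<in> uverts G. udist G v u \<le> enat r}"

definition parts_meeting :: "'a set \<Rightarrow> 'a set set \<Rightarrow> 'a set set" where
  "parts_meeting X P = {A \<in> P. A \<inter> X \<noteq> {}}"

definition homogeneous_modulo :: "'a ugraph \<Rightarrow> 'a set set \<Rightarrow> 'a set set \<Rightarrow> bool" where
  "homogeneous_modulo G P R \<longleftrightarrow>
     (\<forall>X\<in>P. \<forall>Y\<in>P.
        (\<forall>x\<in>X. \<forall>y\<in>Y. x \<noteq> y \<and> {x, y} \<notin> R \<longrightarrow> {x, y} \<in> uedges G) \<or>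
        (\<forall>x\<in>X. \<forall>y\<in>Y. x \<noteq> y \<and> {x, y} \<notin> R \<longrightarrow> {x, y} \<notin> uedges G))"

text \<open>
  Only the values \<open>P t\<close>, \<open>R t\<close> with \<open>1 \<le> t \<le> m\<close> matter. The last partition is \<open>{V(G)}\<close>; removing
  the empty part only affects the graph without vertices, whose unique partition is empty.
\<close>

definition merge_sequence ::
    "'a ugraph \<Rightarrow> nat \<Rightarrow> (nat \<Rightarrow> 'a set set) \<Rightarrow> (nat \<Rightarrow> 'a set set) \<Rightarrow> bool" where
  "merge_sequence G m P R \<longleftrightarrow>
     1 \<le> m \<and>
     (\<forall>t\<in>{1..m}. partition_on (uverts G) (P t) \<and> R t \<subseteq> nsets (uverts G) 2 \<and>
        homogeneous_modulo G (P t) (R t)) \<and>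
     P 1 = (\<lambda>v. {v}) ` uverts G \<and>
     P m = {uverts G} - {{}} \<and>
     (\<forall>t\<in>{1..<m}. refines (uverts G) (P t) (P (Suc t)) \<and> R t \<subseteq> R (Suc t))"

text \<open>On \<open>nat\<close>, \<open>SUP\<close> is the maximum for finite nonempty families and \<open>0\<close> for the empty family.\<close>

definition merge_width_of ::
    "'a ugraph \<Rightarrow> nat \<Rightarrow> (nat \<Rightarrow> 'a set set) \<Rightarrow> (nat \<Rightarrow> 'a set set) \<Rightarrow> nat \<Rightarrow> nat" where
  "merge_width_of G m P R r =
     (SUP t \<in> {1..<m}. SUP v \<in> uverts G.
        card (parts_meeting (uball (uverts G, R (Suc t)) r v) (P t)))"

definition universally_bounded_merge_width :: "'a ugraph set \<Rightarrow> bool" where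
  "universally_bounded_merge_width C \<longleftrightarrow>
     (\<exists>f :: nat \<Rightarrow> nat. \<forall>G\<in>C. \<exists>m P R.
        merge_sequence G m P R \<and> (\<forall>r. merge_width_of G m P R r \<le> f r))"

text \<open>A total order is given by its reflexive relation \<open>L\<close>, where \<open>(x, y) \<in> L\<close> means \<open>x \<le> y\<close>.\<close>

definition strongly_reachable :: "'a ugraph \<Rightarrow> 'a rel \<Rightarrow> nat \<Rightarrow> 'a \<Rightarrow> 'a set" where
  "strongly_reachable H L r v =
     {u \<in> uverts H. (u, v) \<in> L \<and>
        (\<exists>p. upath H v p u \<and> length p - 1 \<le> r \<and>
           (\<forall>w \<in> set (butlast (tl p)). (v, w) \<in> L \<and> w \<noteq> v))}"

definition scol :: "nat \<Rightarrow> 'a ugraph \<Rightarrow> nat" where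
  "scol r H =
     (INF L \<in> {L. linear_order_on (uverts H) L}.
        SUP v \<in> uverts H. card (strongly_reachable H L r v))"

definition bounded_expansion :: "'a ugraph set \<Rightarrow> bool" where
  "bounded_expansion D \<longleftrightarrow> (\<forall>r. bdd_above (scol r ` D))"

definition quasi_isometry :: "real \<Rightarrow> real \<Rightarrow> 'a ugraph \<Rightarrow> 'b ugraph \<Rightarrow> ('a \<Rightarrow> 'b) \<Rightarrow> bool" where
  "quasi_isometry a b G H \<phi> \<longleftrightarrow>
     \<phi> ` uverts G \<subseteq> uverts H \<and>
     (\<forall>x\<in>uverts G. \<forall>x'\<in>uverts G.
        ereal (1 / a) * ereal_of_enat (udist G x x') - ereal b
          \<le> ereal_of_enat (udist H (\<phi> x) (\<phi> x')) \<and>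
        ereal_of_enat (udist H (\<phi> x) (\<phi> x'))
          \<le> ereal a * ereal_of_enat (udist G x x') + ereal b) \<and>
     (\<forall>y\<in>uverts H. \<exists>x\<in>uverts G. ereal_of_enat (udist H y (\<phi> x)) \<le> ereal b)"

definition quasi_isometric :: "real \<Rightarrow> real \<Rightarrow> 'a ugraph \<Rightarrow> 'b ugraph \<Rightarrow> bool" where
  "quasi_isometric a b G H \<longleftrightarrow> (\<exists>\<phi>. quasi_isometry a b G H \<phi>)"

end

theory Submission imports Defs begin

text \<open>
  Call a pair of parts at time \<open>t\<close> open if some edge of \<open>G\<close> between them joins vertices at distance
  more than \<open>5\<close> in \<open>R\<^sub>t\<close>. A vertex \<open>x\<close> is alive as long as, for some edge \<open>x y\<close>, the parts of \<open>x\<close> and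
  \<open>y\<close> have been open at all times so far. Homogeneity implies that, among three vertices of the same
  part that die at the same time, two are at distance at most \<open>6\<close> in \<open>G\<close>; hence each such class is
  covered by two balls of radius \<open>6\<close>. The graph \<open>H\<close> is obtained from \<open>G\<close> by contracting the traces of
  these balls on the classes, which distorts distances by at most \<open>d \<mapsto> 13 d + 12\<close>.

  To bound the strong colouring numbers of \<open>H\<close>, order its vertices by decreasing time of death. If
  \<open>v\<close> dies at time \<open>t\<close>, a path witnessing strong reachability from \<open>v\<close> lifts to a walk in a power of
  \<open>R\<^sub>t\<^sub>+\<^sub>1\<close>, and therefore ends in one of boundedly many parts of \<open>P\<^sub>t\<close>. Within one such part only
  boundedly many times of death after \<open>t\<close> occur.
\<close>

section \<open>Walks\<close>

text \<open>Walks, unlike paths, concatenate without any truncation, so all distance estimates are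
  made with \<open>near\<close>. No vertex set is involved: every point is joined to itself by the
  empty walk.\<close>

definition near :: "'a set set \<Rightarrow> nat \<Rightarrow> 'a \<Rightarrow> 'a \<Rightarrow> bool" where
  "near E n x y \<longleftrightarrow> (\<exists>k\<le>n. (x, y) \<in> {(a, b). {a, b} \<in> E} ^^ k)"

lemma near_refl [simp]: "near E n x x"
  unfolding near_def by (rule exI[of _ 0]) auto

lemma near_edge: "{x, y} \<in> E \<Longrightarrow> 1 \<le> n \<Longrightarrow> near E n x y"
  unfolding near_def by (rule exI[of _ 1]) auto

lemma near_trans:
  assumes "near E i x y" "near E j y z" "i + j \<le> n"
  shows "near E n x z"
proof -
  obtain a b where "a \<le> i" "(x, y) \<in> {(a, b). {a, b} \<in> E} ^^ a"
      "b \<le> j" "(y, z) \<in> {(a, b). {a, b} \<in> E} ^^ b"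
    using assms(1,2) unfolding near_def by blast
  then show ?thesis
    using assms(3) unfolding near_def
    by (intro exI[of _ "a + b"]) (auto simp: relpow_add)
qed

lemma near_mono: "near E i x y \<Longrightarrow> i \<le> j \<Longrightarrow> near E j x y"
  unfolding near_def using order_trans by blast

lemma near_mono_edges:
  assumes "near E n x y" "E \<subseteq> F"
  shows "near F n x y"
proof -
  have "(x, y) \<in> {(a, b). {a, b} \<in> F} ^^ k" if "(x, y) \<in> {(a, b). {a, b} \<in> E} ^^ k" for k
    using that assms(2) by (induction k arbitrary: y) auto
  then show ?thesis
    using assms(1) unfolding near_def by blast
qed

lemma near_sym:
  assumes "near E n x y"
  shows "near E n y x"
proof -
  have "sym {(a, b). {a, b} \<in> E}"
    by (auto simp: sym_def insert_commute)
  then have "sym ({(a, b). {a, b} \<in> E} ^^ k)" for k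
  proof (induction k)
    case (Suc k)
    show ?case
    proof (rule symI)
      fix x y assume "(x, y) \<in> {(a, b). {a, b} \<in> E} ^^ Suc k"
      then obtain z where "(x, z) \<in> {(a, b). {a, b} \<in> E} ^^ k" "{z, y} \<in> E"
        by auto
      then have "(z, x) \<in> {(a, b). {a, b} \<in> E} ^^ k" "{y, z} \<in> E"
        using Suc by (auto simp: sym_def insert_commute)
      then show "(y, x) \<in> {(a, b). {a, b} \<in> E} ^^ Suc k"
        by (intro relpow_Suc_I2) auto
    qed
  qed (auto simp: sym_def)
  then show ?thesis
    using assms unfolding near_def sym_def by blast
qed

lemma near_SucE:
  assumes "near E (Suc n) x z"
  obtains "x = z" | y where "near E n x y" "{y, z} \<in> E"
proof -
  obtain k where k: "k \<le> Suc n" "(x, z) \<in> {(a, b). {a, b} \<in> E} ^^ k"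
    using assms unfolding near_def by blast
  show thesis
  proof (cases k)
    case 0
    then show ?thesis using k that(1) by simp
  next
    case (Suc j)
    then obtain y where "(x, y) \<in> {(a, b). {a, b} \<in> E} ^^ j" "{y, z} \<in> E"
      using k by auto
    then show ?thesis
      using that(2) k(1) Suc unfolding near_def by auto
  qed
qed

lemma near_0 [simp]: "near E 0 x y \<longleftrightarrow> x = y"
  by (auto simp: near_def)

lemma nsets2_edge: "E \<subseteq> nsets V 2 \<Longrightarrow> {x, y} \<in> E \<Longrightarrow> x \<in> V \<and> y \<in> V \<and> x \<noteq> y"
  by (fastforce simp: nsets_def card_insert_if split: if_splits)

lemma upath_imp_near:
  assumes "upath G x p y"
  shows "near (uedges G) (length p - 1) x y"
proof -
  have p: "p \<noteq> []" "hd p = x" "last p = y"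
      "\<And>i. Suc i < length p \<Longrightarrow> {p ! i, p ! Suc i} \<in> uedges G"
    using assms unfolding upath_def by auto
  have "near (uedges G) i x (p ! i)" if "i < length p" for i
    using that
  proof (induction i)
    case 0
    then show ?case using p by (simp add: hd_conv_nth)
  next
    case (Suc i)
    then show ?case
      using near_trans[of _ i x "p ! i" 1] near_edge[OF p(4)] by simp
  qed
  from this[of "length p - 1"] show ?thesis
    using p by (simp add: last_conv_nth)
qed

lemma near_imp_upath:
  assumes E: "E \<subseteq> nsets V 2" and "near E n x y" "x \<in> V"
  shows "\<exists>p. upath (V, E) x p y \<and> length p - 1 \<le> n"
  using assms(2)
proof (induction n arbitrary: y)
  case 0
  then show ?case
    using assms(3) by (intro exI[of _ "[x]"]) (auto simp: upath_def)
next
  case (Suc n)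
  from Suc.prems show ?case
  proof (cases rule: near_SucE)
    case 1
    then show ?thesis
      using assms(3) by (intro exI[of _ "[x]"]) (auto simp: upath_def)
  next
    case (2 z)
    then obtain p where p: "upath (V, E) x p z" "length p - 1 \<le> n"
      using Suc.IH by blast
    show ?thesis
    \<comment> \<open>To keep the vertices distinct, the path is cut at an earlier visit to
      \<open>y\<close> if there is one, and extended by \<open>y\<close> otherwise.\<close>
    proof (cases "y \<in> set p")
      case True
      then obtain as bs where ab: "p = as @ y # bs"
        by (meson split_list)
      have "upath (V, E) x (as @ [y]) y"
        unfolding upath_def
      proof (intro conjI allI impI)
        show "hd (as @ [y]) = x"
          using p(1) ab by (cases as) (auto simp: upath_def)
        fix i assume i: "Suc i < length (as @ [y])"
        then have "(as @ [y]) ! i = p ! i" "(as @ [y]) ! Suc i = p ! Suc i"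
          using ab by (auto simp: nth_append less_Suc_eq)
        then show "{(as @ [y]) ! i, (as @ [y]) ! Suc i} \<in> uedges (V, E)"
          using p(1) ab i by (simp add: upath_def)
      qed (use p(1) ab in \<open>auto simp: upath_def\<close>)
      moreover have "length (as @ [y]) - 1 \<le> Suc n"
        using p(2) ab by simp
      ultimately show ?thesis by blast
    next
      case False
      have pp: "p \<noteq> []" "hd p = x" "last p = z" "distinct p" "set p \<subseteq> V"
          "\<And>i. Suc i < length p \<Longrightarrow> {p ! i, p ! Suc i} \<in> E"
        using p(1) unfolding upath_def by auto
      have "upath (V, E) x (p @ [y]) y"
        unfolding upath_def
      proof (intro conjI allI impI)
        fix i assume i: "Suc i < length (p @ [y])"
        show "{(p @ [y]) ! i, (p @ [y]) ! Suc i} \<in> uedges (V, E)"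
        proof (cases "Suc i < length p")
          case True
          then show ?thesis using pp(6) by (simp add: nth_append)
        next
          case False
          then have "i = length p - 1" "Suc i = length p"
            using i by auto
          then show ?thesis
            using 2(2) pp by (simp add: nth_append last_conv_nth)
        qed
      qed (use pp False nsets2_edge[OF E 2(2)] in auto)
      moreover have "length (p @ [y]) - 1 \<le> Suc n"
        using p(2) pp(1) by simp
      ultimately show ?thesis by blast
    qed
  qed
qed

text \<open>A finite distance is an infimum over a nonempty set, hence attained by well-foundedness
  of \<open>enat\<close>. Membership of \<open>x\<close> in \<open>V\<close> matters for the empty
  walk, which yields a path only inside the graph.\<close>

lemma udist_le_iff_near:
  assumes "E \<subseteq> nsets V 2" "x \<in> V"
  shows "udist (V, E) x y \<le> enat n \<longleftrightarrow> near E n x y"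
proof
  assume le: "udist (V, E) x y \<le> enat n"
  let ?S = "(\<lambda>p. enat (length p - 1)) ` {p. upath (V, E) x p y}"
  have "?S \<noteq> {}"
  proof
    assume "?S = {}"
    then have "udist (V, E) x y = \<infinity>"
      unfolding udist_def by (simp only: Inf_enat_def if_True simp_thms)
    then show False using le by simp
  qed
  then have "Inf ?S \<in> ?S"
    by (meson ex_in_conv wellorder_InfI)
  then obtain p where "upath (V, E) x p y" "udist (V, E) x y = enat (length p - 1)"
    unfolding udist_def by auto
  then show "near E n x y"
    using upath_imp_near[of "(V, E)" x p y] le near_mono by fastforce
next
  assume "near E n x y"
  then obtain p where "upath (V, E) x p y" "length p - 1 \<le> n"
    using near_imp_upath assms by metis
  then show "udist (V, E) x y \<le> enat n"
    unfolding udist_def by (intro INF_lower2[of p]) auto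
qed

section \<open>Sparse quotients of a merge sequence\<close>

text \<open>
  A merge sequence is presented by the maps \<open>c t\<close> sending a vertex to its part at time \<open>t\<close>. Time
  \<open>0\<close> is an additional copy of the first step.
\<close>

locale merge_data =
  fixes V :: "'a set" and E :: "'a set set" and m :: nat
    and c :: "nat \<Rightarrow> 'a \<Rightarrow> 'b" and R :: "nat \<Rightarrow> 'a set set" and g :: "nat \<Rightarrow> nat"
  assumes finite_V: "finite V"
    and E_V: "E \<subseteq> nsets V 2"
    and R_mono: "s \<le> t \<Longrightarrow> t \<le> m \<Longrightarrow> R s \<subseteq> R t"
    and c_mono: "s \<le> t \<Longrightarrow> t \<le> m \<Longrightarrow> x \<in> V \<Longrightarrow> y \<in> V \<Longrightarrow> c s x = c s y \<Longrightarrow> c t x = c t y"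
    and c_0: "x \<in> V \<Longrightarrow> y \<in> V \<Longrightarrow> c 0 x = c 0 y \<Longrightarrow> x = y"
    and c_m: "x \<in> V \<Longrightarrow> y \<in> V \<Longrightarrow> c m x = c m y"
    and homogeneous: "t \<le> m \<Longrightarrow> x' \<in> V \<Longrightarrow> y' \<in> V \<Longrightarrow> c t x = c t x' \<Longrightarrow> c t y = c t y' \<Longrightarrow>
      {x, y} \<in> E \<Longrightarrow> {x, y} \<notin> R t \<Longrightarrow> x' \<noteq> y' \<Longrightarrow> {x', y'} \<notin> R t \<Longrightarrow> {x', y'} \<in> E"
    and width: "t < m \<Longrightarrow> v \<in> V \<Longrightarrow> card (c t ` {u \<in> V. near (R (Suc t)) r v u}) \<le> g r"
begin

lemma edge_verts: "{x, y} \<in> E \<Longrightarrow> x \<in> V \<and> y \<in> V \<and> x \<noteq> y"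
  using nsets2_edge[OF E_V] .

section \<open>Open pairs and times of death\<close>

definition open_pair :: "nat \<Rightarrow> 'a \<Rightarrow> 'a \<Rightarrow> bool" where
  "open_pair t x y \<longleftrightarrow>
     (\<exists>z w. {z, w} \<in> E \<and> c t z = c t x \<and> c t w = c t y \<and> \<not> near (R t) 5 z w)"

text \<open>Openness is not monotone in time: parts grow, which creates candidates, while distances
  in \<open>R t\<close> shrink. Hence the condition on all \<open>t \<le> s\<close>. The inserted 0
  is the default for a vertex without a suitable edge.\<close>

definition death :: "'a \<Rightarrow> nat" where
  "death x = Max (insert 0 {s. s \<le> m \<and> (\<exists>y. {x, y} \<in> E \<and> (\<forall>t\<le>s. open_pair t x y))})"

lemma death_le: "death x \<le> m"
  unfolding death_def by (subst Max_le_iff) auto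

lemma death_ge:
  assumes "s \<le> m" "{x, y} \<in> E" "\<And>t. t \<le> s \<Longrightarrow> open_pair t x y"
  shows "s \<le> death x"
  unfolding death_def using assms by (intro Max_ge) auto

lemma death_witness:
  assumes "0 < death x"
  obtains y where "{x, y} \<in> E" "\<And>t. t \<le> death x \<Longrightarrow> open_pair t x y"
proof -
  let ?S = "{s. s \<le> m \<and> (\<exists>y. {x, y} \<in> E \<and> (\<forall>t\<le>s. open_pair t x y))}"
  have "death x \<in> insert 0 ?S"
    unfolding death_def by (rule Max_in) auto
  then show thesis
    using assms that by auto
qed

lemma open_pair_cong: "c t x = c t x' \<Longrightarrow> c t y = c t y' \<Longrightarrow> open_pair t x y \<longleftrightarrow> open_pair t x' y'"
  unfolding open_pair_def by simp

text \<open>A witness \<open>z w\<close> of openness is an edge that is too far apart to lie in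
  \<open>R t\<close>. By homogeneity all pairs between the two parts outside \<open>R t\<close> are
  then edges.\<close>

lemma open_pairD:
  assumes "open_pair t x y" "t \<le> m" "x \<in> V" "y \<in> V"
  shows "x = y \<or> {x, y} \<in> R t \<or> {x, y} \<in> E"
proof -
  obtain z w where "{z, w} \<in> E" "c t z = c t x" "c t w = c t y" "\<not> near (R t) 5 z w"
    using assms(1) unfolding open_pair_def by blast
  then show ?thesis
    using homogeneous[of t x y z w] near_edge[of z w "R t" 5] assms by auto
qed

lemma not_open_pair_near: "{x, y} \<in> E \<Longrightarrow> \<not> open_pair t x y \<Longrightarrow> near (R t) 5 x y"
  unfolding open_pair_def by blast

lemma near_R_mono: "near (R s) n x y \<Longrightarrow> s \<le> t \<Longrightarrow> t \<le> m \<Longrightarrow> near (R t) n x y"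
  using near_mono_edges R_mono by metis

text \<open>If the pair were open at all times up to \<open>t\<close>, this edge would keep
  \<open>x\<close> alive until \<open>t\<close>. At a time when it is not open, the edge itself is
  short in the relation of that time, and stays so.\<close>

lemma edge_near_after_death:
  assumes "{x, y} \<in> E" "death x < t" "t \<le> m"
  shows "near (R t) 5 x y"
proof -
  obtain s where "s \<le> t" "\<not> open_pair s x y"
    using death_ge[of t x y] assms by force
  then show ?thesis
    using not_open_pair_near near_R_mono assms by blast
qed

section \<open>Classes of vertices that die together\<close>

definition class_of :: "'a \<Rightarrow> 'a set" where
  "class_of x = {y \<in> V. death y = death x \<and> c (death x) y = c (death x) x}"

lemma class_of_self: "x \<in> V \<Longrightarrow> x \<in> class_of x"
  by (simp add: class_of_def)

lemma class_of_eq: "y \<in> class_of x \<Longrightarrow> class_of y = class_of x"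
  by (auto simp: class_of_def)

lemma class_of_death_0: "x \<in> V \<Longrightarrow> death x = 0 \<Longrightarrow> y \<in> class_of x \<Longrightarrow> y = x"
  using c_0 by (auto simp: class_of_def)

text \<open>A partner \<open>b\<close> of \<open>x\<close> at its death forms an open pair with
  \<open>y\<close> too, since \<open>x\<close> and \<open>y\<close> share a part. After the death
  both \<open>x\<close> and \<open>y\<close> are within 5 of \<open>b\<close>.\<close>

lemma class_near_R:
  assumes x: "x \<in> V" and y: "y \<in> class_of x" and t: "death x < t" "t \<le> m"
  shows "near (R t) 10 x y"
proof (cases "death x = 0")
  case True
  then show ?thesis using class_of_death_0[OF x True y] by simp
next
  case False
  obtain b where b: "{x, b} \<in> E" "open_pair (death x) x b"
    using death_witness[of x] False by auto
  have yV: "y \<in> V" "death y = death x" "c (death x) y = c (death x) x"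
    using y by (auto simp: class_of_def)
  have "open_pair (death x) y b"
    using b(2) open_pair_cong[OF yV(3)] by blast
  then consider "y = b" | "{y, b} \<in> R (death x)" | "{y, b} \<in> E"
    using open_pairD[of "death x" y b] yV(1) edge_verts[OF b(1)] death_le by blast
  then have "near (R t) 5 y b"
  proof cases
    case 2
    then show ?thesis using near_R_mono[OF near_edge[OF 2]] t by simp
  next
    case 3
    then show ?thesis using edge_near_after_death[of y b] t yV by simp
  qed simp
  moreover have "near (R t) 5 x b"
    using edge_near_after_death b(1) t by blast
  ultimately show ?thesis
    using near_trans[of "R t" 5 x b 5 y 10] near_sym[of "R t" 5 y b] by simp
qed

text \<open>
  If the three vertices were pairwise far apart in \<open>E\<close>, homogeneity would put all pairs
  \<open>x\<^sub>i y\<^sub>j\<close> with \<open>i \<noteq> j\<close> into \<open>R t\<close>, so that \<open>x\<^sub>1 y\<^sub>3 x\<^sub>2 y\<^sub>1\<close> would be a short walk in \<open>R t\<close>.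
\<close>

lemma three_unresolved_edges:
  fixes x y :: "nat \<Rightarrow> 'a"
  assumes t: "t \<le> m" and e: "\<And>i. i < 3 \<Longrightarrow> {x i, y i} \<in> E"
    and far: "\<And>i. i < 3 \<Longrightarrow> \<not> near (R t) 3 (x i) (y i)"
    and same: "\<And>i. i < 3 \<Longrightarrow> c t (x i) = q"
  shows "\<exists>i j. i < 3 \<and> j < 3 \<and> i \<noteq> j \<and> near E 2 (x i) (x j)"
proof (rule ccontr)
  assume none: "\<not> ?thesis"
  have cross: "{x i, y j} \<in> R t" if ij: "i < 3" "j < 3" "i \<noteq> j" for i j
  proof (rule ccontr)
    assume nR: "{x i, y j} \<notin> R t"
    have yx: "{y j, x j} \<in> E"
      using e[OF ij(2)] by (simp add: insert_commute)
    have nR': "{x j, y j} \<notin> R t"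
      using near_edge[of "x j" "y j" "R t" 3] far[OF ij(2)] by auto
    have "near E 2 (x i) (x j)"
    proof (cases "x i = y j")
      case True
      then show ?thesis using near_edge[OF yx, of 2] by simp
    next
      case False
      have "{x i, y j} \<in> E"
        using homogeneous[OF t _ _ _ refl e[OF ij(2)] nR' False nR] same ij
          edge_verts[OF e[OF ij(1)]] edge_verts[OF e[OF ij(2)]] by simp
      then show ?thesis
        using near_trans[OF near_edge[of _ _ E 1] near_edge[OF yx, of 1]] by simp
    qed
    then show False using none ij by blast
  qed
  have "{x 0, y 2} \<in> R t" "{y 2, x 1} \<in> R t" "{x 1, y 0} \<in> R t"
    using cross[of 0 2] cross[of 1 2] cross[of 1 0] by (auto simp: insert_commute)
  then have "near (R t) 3 (x 0) (y 0)"
    using near_trans[OF near_edge near_trans[OF near_edge near_edge], of "x 0" "y 2" "R t" 1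
        "x 1" 1 "y 0" 1 2 3] by simp
  then show False using far[of 0] by simp
qed

text \<open>This moves \<open>x\<close> to a nearby vertex to which
  \<open>three_unresolved_edges\<close> applies. If the edge \<open>x b\<close> is too short, the
  witness \<open>z w\<close> of openness serves: were \<open>z\<close> far from \<open>x\<close> in
  \<open>E\<close>, both \<open>z b\<close> and \<open>x w\<close> would lie in \<open>R\<close>,
  and the walk from \<open>z\<close> via \<open>b\<close> and \<open>x\<close> to \<open>w\<close>
  would have length at most 1 + 3 + 1 = 5. This is where the threshold 5 comes from.\<close>

lemma near_unresolved_edge:
  assumes "0 < death x"
  obtains z w where "c (death x) z = c (death x) x" "{z, w} \<in> E"
    "\<not> near (R (death x)) 3 z w" "near E 2 x z"
proof -
  let ?s = "death x"
  obtain b where b: "{x, b} \<in> E" "open_pair ?s x b"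
    using death_witness[OF assms] by auto
  show thesis
  proof (cases "near (R ?s) 3 x b")
    case False
    then show ?thesis using that b by simp
  next
    case True
    obtain z w where zw: "{z, w} \<in> E" "c ?s z = c ?s x" "c ?s w = c ?s b" "\<not> near (R ?s) 5 z w"
      using b(2) unfolding open_pair_def by blast
    have V: "x \<in> V" "b \<in> V" "z \<in> V" "w \<in> V"
      using edge_verts b(1) zw(1) by auto
    have "open_pair ?s z b" "open_pair ?s x w"
      using b(2) open_pair_cong zw by metis+
    then have zb: "z = b \<or> {z, b} \<in> R ?s \<or> {z, b} \<in> E"
      and xw: "x = w \<or> {x, w} \<in> R ?s \<or> {x, w} \<in> E"
      using open_pairD V death_le by blast+
    have wz: "{w, z} \<in> E" using zw(1) by (simp add: insert_commute)
    have "near E 2 x z"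
    proof (rule ccontr)
      assume far: "\<not> near E 2 x z"
      have "x \<noteq> w" using far near_edge[OF wz, of 2] by auto
      moreover have "z \<noteq> b" using far near_edge[OF b(1), of 2] by auto
      moreover have "{x, w} \<notin> E"
        using far near_trans[OF near_edge[of x w E 1] near_edge[OF wz, of 1], of 2] by auto
      moreover have "{z, b} \<notin> E"
        using far near_trans[OF near_edge[OF b(1), of 1] near_edge[of b z E 1], of 2]
        by (auto simp: insert_commute)
      ultimately have R: "{z, b} \<in> R ?s" "{x, w} \<in> R ?s"
        using zb xw by auto
      have "near (R ?s) 4 z x"
        using near_trans[OF near_edge[OF R(1), of 1] near_sym[OF True], of 4] by simp
      then have "near (R ?s) 5 z w"
        using near_trans[OF _ near_edge[OF R(2), of 1], of 4 z 5] by simp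
      then show False using zw(4) by simp
    qed
    moreover have "\<not> near (R ?s) 3 z w"
      using zw(4) near_mono by fastforce
    ultimately show ?thesis using that zw by blast
  qed
qed

text \<open>Each vertex moves by at most 2 to the end of an unresolved edge, and two of these ends
  are within 2, which gives 2 + 2 + 2 = 6. Death at time 0 is separate, as it may be the default
  value; the class is then a singleton.\<close>

lemma three_in_class:
  fixes x :: "nat \<Rightarrow> 'a"
  assumes v: "v \<in> V" and x: "\<And>i. i < 3 \<Longrightarrow> x i \<in> class_of v"
  shows "\<exists>i j. i < 3 \<and> j < 3 \<and> i \<noteq> j \<and> near E 6 (x i) (x j)"
proof (cases "death v = 0")
  case True
  then have "x 0 = v" "x 1 = v"
    using class_of_death_0[OF v True] x by auto
  then show ?thesis
    by (intro exI[of _ 0] exI[of _ 1]) simp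
next
  case False
  have "\<exists>z w. c (death v) z = c (death v) v \<and> {z, w} \<in> E \<and> \<not> near (R (death v)) 3 z w \<and>
      near E 2 (x i) z" if "i < 3" for i
  proof -
    have "death (x i) = death v" "c (death v) (x i) = c (death v) v"
      using x[OF that] by (auto simp: class_of_def)
    then show ?thesis
      using near_unresolved_edge[of "x i"] False by (metis gr0I)
  qed
  then obtain z w where zw: "\<And>i. i < 3 \<Longrightarrow> c (death v) (z i) = c (death v) v \<and> {z i, w i} \<in> E \<and>
      \<not> near (R (death v)) 3 (z i) (w i) \<and> near E 2 (x i) (z i)"
    by metis
  then obtain i j where ij: "i < 3" "j < 3" "i \<noteq> j" "near E 2 (z i) (z j)"
    using three_unresolved_edges[of "death v" z w "c (death v) v"] death_le by blast
  have "near E 4 (x i) (z j)"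
    using near_trans[of E 2 "x i" "z i" 2 "z j" 4] zw[OF ij(1)] ij(4) by simp
  then have "near E 6 (x i) (x j)"
    using near_trans[of E 4 "x i" "z j" 2 "x j" 6] zw[OF ij(2)] near_sym by fastforce
  then show ?thesis using ij by blast
qed

text \<open>If \<open>v\<close> alone does not suffice, some \<open>a\<close> is far from
  \<open>v\<close>, and any further vertex is close to one of them by
  \<open>three_in_class\<close>.\<close>

lemma class_two_centres:
  assumes "v \<in> V"
  shows "\<exists>a b. a \<in> class_of v \<and> b \<in> class_of v \<and>
    (\<forall>x\<in>class_of v. near E 6 x a \<or> near E 6 x b)"
proof (cases "\<forall>x\<in>class_of v. near E 6 x v")
  case True
  then show ?thesis using class_of_self[OF assms] by blast
next
  case False
  then obtain a where a: "a \<in> class_of v" "\<not> near E 6 a v" by blast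
  have "near E 6 x a \<or> near E 6 x v" if "x \<in> class_of v" for x
  proof -
    define y :: "nat \<Rightarrow> 'a" where "y = (\<lambda>i. if i = 0 then x else if i = 1 then a else v)"
    have "y i \<in> class_of v" for i
      using that a class_of_self[OF assms] by (simp add: y_def)
    then obtain i j where "i < 3" "j < 3" "i \<noteq> j" "near E 6 (y i) (y j)"
      using three_in_class[OF assms, of y] by blast
    then show ?thesis
      using a(2) near_sym unfolding y_def by (fastforce split: if_splits)
  qed
  then show ?thesis
    using a(1) class_of_self[OF assms] by blast
qed

definition centres :: "'a set \<Rightarrow> 'a \<times> 'a" where
  "centres K = (SOME p. fst p \<in> K \<and> snd p \<in> K \<and> (\<forall>x\<in>K. near E 6 x (fst p) \<or> near E 6 x (snd p)))"

text \<open>The centres are chosen from the class as a set, so all its members use the same two. The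
  fibres of \<open>leader\<close> are what is contracted; a leader is a label of its fibre and may
  itself lie in another one, as \<open>snd p\<close> is sent to \<open>fst p\<close> when they are
  close.\<close>

definition leader :: "'a \<Rightarrow> 'a" where
  "leader x = (let p = centres (class_of x) in if near E 6 x (fst p) then fst p else snd p)"

lemma leader_props:
  assumes "x \<in> V"
  shows "leader x \<in> class_of x" "near E 6 x (leader x)"
proof -
  let ?K = "class_of x"
  have "\<exists>p. fst p \<in> ?K \<and> snd p \<in> ?K \<and> (\<forall>x\<in>?K. near E 6 x (fst p) \<or> near E 6 x (snd p))"
    using class_two_centres[OF assms] by simp
  from someI_ex[OF this] show "leader x \<in> class_of x" "near E 6 x (leader x)"
    using class_of_self[OF assms] unfolding leader_def Let_def centres_def by auto
qed

lemma leader_cong: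
  assumes "x \<in> V" "y \<in> V" "leader x = leader y"
  shows "y \<in> class_of x" "near E 12 x y"
proof -
  have "class_of x = class_of y"
    using leader_props(1) class_of_eq assms by metis
  then show "y \<in> class_of x"
    using class_of_self assms by simp
  show "near E 12 x y"
    using near_trans[of E 6 x "leader x" 6 y 12] leader_props(2) assms near_sym by fastforce
qed

lemma leader_class_card:
  "finite (leader ` class_of x)" "card (leader ` class_of x) \<le> 2"
proof -
  have sub: "leader ` class_of x \<subseteq> {fst (centres (class_of x)), snd (centres (class_of x))}"
    using class_of_eq by (fastforce simp: leader_def Let_def)
  then show "finite (leader ` class_of x)"
    by (rule finite_subset) simp
  show "card (leader ` class_of x) \<le> 2"
    by (rule order_trans[OF card_mono[OF _ sub]]) (auto intro: card_insert_le_m1)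
qed

section \<open>Counting the vertices alive in a part\<close>

definition alive :: "nat \<Rightarrow> 'b \<Rightarrow> 'a set" where
  "alive t q = {y \<in> V. c t y = q \<and> t \<le> death y}"

text \<open>
  Let \<open>y\<^sub>1\<close> die first among the vertices of \<open>alive t q\<close>. A partner \<open>b\<close> keeping a later vertex alive is
  joined to \<open>y\<^sub>1\<close> by a short walk in \<open>R t\<close>, as otherwise \<open>y\<^sub>1 b\<close> would be an edge keeping \<open>y\<^sub>1\<close> alive
  too. So the partners lie in few parts, and the part of the partner determines the time of death.
\<close>

lemma alive_deaths:
  assumes t: "t < m"
  shows "card (death ` alive t q) \<le> Suc (g 5)"
proof (cases "alive t q = {}")
  case False
  define d where "d = Min (death ` alive t q)"
  have fin: "finite (alive t q)"
    using finite_V by (simp add: alive_def)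
  have "d \<in> death ` alive t q"
    unfolding d_def by (rule Min_in) (use fin False in auto)
  then obtain y1 where y1: "y1 \<in> alive t q" "death y1 = d" by auto
  have dmin: "d \<le> death y" if "y \<in> alive t q" for y
    unfolding d_def by (rule Min_le) (use fin that in auto)
  have "\<exists>b. {y, b} \<in> E \<and> (\<forall>s\<le>death y. open_pair s y b)" if "d < death y" for y
    using death_witness[of y] that by (metis gr_implies_not0 gr0I)
  then obtain b where b: "\<And>y. d < death y \<Longrightarrow> {y, b y} \<in> E"
      "\<And>y s. d < death y \<Longrightarrow> s \<le> death y \<Longrightarrow> open_pair s y (b y)"
    by metis
  \<comment> \<open>The earliest time \<open>d\<close> is set aside; it accounts for the
    \<open>Suc\<close> in the bound.\<close>
  define S where "S = death ` alive t q - {d}"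
  have "\<exists>y. y \<in> alive t q \<and> death y = s" if "s \<in> S" for s
    using that by (auto simp: S_def)
  then obtain w where w: "\<And>s. s \<in> S \<Longrightarrow> w s \<in> alive t q \<and> death (w s) = s"
    by metis
  have later: "d < s" if "s \<in> S" for s
    using dmin[of "w s"] w[OF that] that by (auto simp: S_def)
  have same: "c s y = c s y'" if "y \<in> alive t q" "y' \<in> alive t q" "t \<le> s" "s \<le> m" for s y y'
    using c_mono[OF that(3,4)] that(1,2) by (simp add: alive_def)
  define B where "B = (\<lambda>s. b (w s))"
  have B: "{w s, B s} \<in> E" "\<And>s'. s' \<le> s \<Longrightarrow> open_pair s' (w s) (B s)" if "s \<in> S" for s
    using b[of "w s"] w[OF that] later[OF that] by (auto simp: B_def)
  have BV: "B s \<in> V" if "s \<in> S" for s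
    using B(1)[OF that] edge_verts by blast
  have ts: "t \<le> s" "s \<le> m" if "s \<in> S" for s
    using w[OF that] death_le[of "w s"] by (auto simp: alive_def)
  have nearB: "near (R (Suc t)) 5 y1 (B s)" if s: "s \<in> S" for s
  proof -
    have "open_pair t y1 (B s)"
      using B(2)[OF s, of t] ts[OF s] open_pair_cong same[OF y1(1), of "w s" t] w[OF s] t
      by (metis less_imp_le order_refl)
    then consider "y1 = B s" | "{y1, B s} \<in> R t" | "{y1, B s} \<in> E"
      using open_pairD[of t y1 "B s"] y1(1) BV[OF s] t by (auto simp: alive_def)
    then have "near (R t) 5 y1 (B s)"
    proof cases
      case 2
      then show ?thesis using near_edge by fastforce
    next
      case 3
      obtain s' where s': "s' \<le> s" "\<not> open_pair s' y1 (B s)"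
        using death_ge[OF ts(2)[OF s] 3] later[OF s] y1(2) by force
      \<comment> \<open>From time \<open>t\<close> on, \<open>y1\<close> and \<open>w s\<close>
        share a part, so the pair with \<open>B s\<close> stays open up to \<open>s\<close>. It must
        therefore have been closed before \<open>t\<close>.\<close>
      have "s' < t"
      proof (rule ccontr)
        assume "\<not> s' < t"
        then have "c s' y1 = c s' (w s)"
          using same[OF y1(1), of "w s" s'] w[OF s] s'(1) ts[OF s] by simp
        then show False
          using s' B(2)[OF s, of s'] open_pair_cong by blast
      qed
      then show ?thesis
        using near_R_mono[OF not_open_pair_near[OF 3 s'(2)], of t] t by simp
    qed simp
    then show ?thesis using near_R_mono t by simp
  qed
  have "inj_on (\<lambda>s. c t (B s)) S"
  proof (rule linorder_inj_onI')
    fix s s' assume s: "s \<in> S" and s': "s' \<in> S" and less: "s < s'"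
    show "c t (B s) \<noteq> c t (B s')"
    proof
      assume eq: "c t (B s) = c t (B s')"
      \<comment> \<open>From time \<open>t\<close> on, the two edges run between the same parts, so
        \<open>B s\<close> would keep \<open>w s\<close> alive until \<open>s'\<close>, beyond its
        death at \<open>s\<close>.\<close>
      have "open_pair i (w s) (B s)" if "i \<le> s'" for i
      proof (cases "i \<le> s")
        case True
        then show ?thesis using B(2)[OF s] by simp
      next
        case False
        then have "t \<le> i" "i \<le> m"
          using ts[OF s] ts[OF s'] that by auto
        then have "c i (w s) = c i (w s')" "c i (B s) = c i (B s')"
          using same w s s' c_mono[of t i "B s" "B s'"] BV eq by auto
        then show ?thesis
          using B(2)[OF s' that] open_pair_cong by blast
      qed
      then have "s' \<le> death (w s)"
        using death_ge[OF ts(2)[OF s'] B(1)[OF s]] by blast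
      then show False using w[OF s] less by simp
    qed
  qed
  then have "card S = card ((\<lambda>s. c t (B s)) ` S)"
    by (simp add: card_image)
  also have "\<dots> \<le> card (c t ` {u \<in> V. near (R (Suc t)) 5 y1 u})"
    by (rule card_mono) (use finite_V BV nearB in auto)
  also have "\<dots> \<le> g 5"
    using width[OF t] y1(1) by (simp add: alive_def)
  finally have "card S \<le> g 5" .
  then show ?thesis
    unfolding S_def using fin card_Diff_singleton_if[of "death ` alive t q" d]
    by (auto split: if_splits)
qed simp

text \<open>Vertices of one part with a common later time of death still share a part at that time,
  so they form part of one class and have at most two leaders.\<close>

lemma alive_leaders:
  assumes t: "t < m"
  shows "card (leader ` alive t q) \<le> 2 * Suc (g 5)"
proof -
  have fin: "finite (alive t q)"
    using finite_V by (simp add: alive_def)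
  let ?D = "\<lambda>s. {y \<in> alive t q. death y = s}"
  have UN: "leader ` alive t q = (\<Union>s\<in>death ` alive t q. leader ` ?D s)"
    by blast
  have "card (leader ` alive t q) \<le> (\<Sum>s\<in>death ` alive t q. card (leader ` ?D s))"
    unfolding UN by (rule card_UN_le) (use fin in simp)
  also have "\<dots> \<le> (\<Sum>s\<in>death ` alive t q. 2)"
  proof (rule sum_mono)
    fix s assume "s \<in> death ` alive t q"
    then obtain x where x: "x \<in> alive t q" "death x = s" by blast
    have "c s y = c s x" if "y \<in> ?D s" for y
      using that x c_mono[of t s y x] death_le[of x] by (simp add: alive_def)
    then have "?D s \<subseteq> class_of x"
      using x(2) by (auto simp: class_of_def alive_def)
    then have "card (leader ` ?D s) \<le> card (leader ` class_of x)"
      by (intro card_mono leader_class_card image_mono)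
    then show "card (leader ` ?D s) \<le> 2"
      using leader_class_card(2)[of x] by simp
  qed
  also have "\<dots> \<le> 2 * Suc (g 5)"
    using alive_deaths[OF t, of q] by simp
  finally show ?thesis .
qed

text \<open>The width bound stops before \<open>m\<close>, but at \<open>m\<close> there is a single
  part, so the vertices dying then form one class.\<close>

lemma top_leaders: "card (leader ` {y \<in> V. death y = m}) \<le> 2"
proof (cases "\<exists>x\<in>V. death x = m")
  case True
  then obtain x where x: "x \<in> V" "death x = m" by blast
  have "c m y = c m x" if "y \<in> V" for y
    by (rule c_m[OF that x(1)])
  then have "{y \<in> V. death y = m} = class_of x"
    using x(2) by (auto simp: class_of_def)
  then show ?thesis using leader_class_card(2) by simp
next
  case False
  then have "{y \<in> V. death y = m} = {}" by blast
  then show ?thesis by (simp only: image_empty card.empty)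
qed

lemma leader_in_V: "x \<in> V \<Longrightarrow> leader x \<in> V"
  and death_leader: "x \<in> V \<Longrightarrow> death (leader x) = death x"
  using leader_props(1)[of x] unfolding class_of_def by blast+

end

section \<open>The contracted graph\<close>

locale encoded_merge_data = merge_data +
  fixes code :: "'a \<Rightarrow> nat"
  assumes inj_code: "inj_on code V"
begin

text \<open>Passing to natural numbers puts the quotients of all graphs into one type.\<close>

definition h :: "'a \<Rightarrow> nat" where
  "h x = code (leader x)"

definition HE :: "nat set set" where
  "HE = {{h x, h y} | x y. {x, y} \<in> E \<and> h x \<noteq> h y}"

text \<open>Decoding a vertex of the quotient gives a leader, which dies together with its whole
  fibre.\<close>

definition hdeath :: "nat \<Rightarrow> nat" where
  "hdeath n = death (inv_into V code n)"

lemma hdeath_h: "x \<in> V \<Longrightarrow> hdeath (h x) = death x"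
  unfolding hdeath_def h_def using inj_code leader_in_V death_leader by (simp add: inv_into_f_f)

lemma h_cong:
  assumes "x \<in> V" "y \<in> V" "h x = h y"
  shows "y \<in> class_of x" "near E 12 x y"
proof -
  have "leader x = leader y"
    using assms inj_onD[OF inj_code] leader_in_V by (simp add: h_def)
  then show "y \<in> class_of x" "near E 12 x y"
    using leader_cong assms by blast+
qed

lemma HE_sub: "HE \<subseteq> nsets (h ` V) 2"
  unfolding HE_def nsets_def using edge_verts by (auto simp: card_insert_if)

lemma HE_lift:
  assumes "{u, v} \<in> HE"
  obtains x y where "{x, y} \<in> E" "h x = u" "h y = v"
proof -
  obtain x y where xy: "{u, v} = {h x, h y}" "{x, y} \<in> E"
    using assms unfolding HE_def by blast
  then have "{y, x} \<in> E" by (simp add: insert_commute)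
  then show thesis
    using that xy by (auto simp: doubleton_eq_iff)
qed

lemma near_h:
  assumes "near E n x y"
  shows "near HE n (h x) (h y)"
  using assms
proof (induction n arbitrary: y)
  case (Suc n)
  from Suc.prems show ?case
  proof (cases rule: near_SucE)
    case (2 z)
    have "near HE 1 (h z) (h y)"
      using 2(2) near_edge[of "h z" "h y" HE 1] unfolding HE_def
      by (cases "h z = h y") auto
    then show ?thesis
      using near_trans[OF Suc.IH[OF 2(1)]] by simp
  qed simp
qed simp

text \<open>A walk with \<open>n\<close> edges passes through \<open>n + 1\<close> fibres; each edge
  costs 1 and each fibre at most 12.\<close>

lemma near_h_lift:
  assumes "near HE n (h x) (h y)" "x \<in> V" "y \<in> V"
  shows "near E (13 * n + 12) x y"
  using assms(1,3)
proof (induction n arbitrary: y)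
  case 0
  then show ?case using h_cong(2) assms(2) by simp
next
  case (Suc n)
  from Suc.prems(1) show ?case
  proof (cases rule: near_SucE)
    case 1
    then show ?thesis
      using h_cong(2)[OF assms(2) Suc.prems(2)] near_mono by fastforce
  next
    case (2 w)
    obtain a b where ab: "{a, b} \<in> E" "h a = w" "h b = h y"
      using HE_lift[OF 2(2)] by blast
    have V: "a \<in> V" "b \<in> V" using edge_verts[OF ab(1)] by auto
    have "near E (13 * n + 12) x a"
      using Suc.IH[of a] 2(1) ab(2) V by simp
    then have "near E (13 * n + 13) x b"
      using near_trans[OF _ near_edge[OF ab(1), of 1]] by simp
    then show ?thesis
      using near_trans[OF _ h_cong(2)[OF V(2) Suc.prems(2) ab(3)]] by simp
  qed
qed

section \<open>The order by time of death and strong reachability\<close>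

definition HL :: "nat rel" where
  "HL = {(u, v). u \<in> h ` V \<and> v \<in> h ` V \<and>
     (hdeath v < hdeath u \<or> hdeath u = hdeath v \<and> u \<le> v)}"

lemma HL_linear: "linear_order_on (h ` V) HL"
  unfolding linear_order_on_def partial_order_on_def preorder_on_def HL_def
    refl_on_def trans_def antisym_def total_on_def by auto

lemma HL_D: "(u, v) \<in> HL \<Longrightarrow> hdeath v \<le> hdeath u"
  unfolding HL_def by auto

text \<open>Each step costs at most 10 inside a class and 5 along an edge, both in
  \<open>R (Suc t)\<close>. Only the tail of a step has to be dead by time \<open>t\<close>, so the
  last vertex of the path may die later.\<close>

lemma path_lift:
  assumes p: "upath (h ` V, HE) v p u" and x: "x \<in> V" "h x = v" and t: "hdeath v \<le> t" "t < m"
    and int: "\<And>w. w \<in> set (butlast (tl p)) \<Longrightarrow> hdeath w \<le> t"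
    and i: "i < length p"
  shows "\<exists>y\<in>V. h y = p ! i \<and> near (R (Suc t)) (15 * i) x y"
  using i
proof (induction i)
  case 0
  then show ?case
    using p x by (intro bexI[of _ x]) (auto simp: upath_def hd_conv_nth)
next
  case (Suc i)
  then obtain y where y: "y \<in> V" "h y = p ! i" "near (R (Suc t)) (15 * i) x y"
    by auto
  have "{p ! i, p ! Suc i} \<in> HE"
    using p Suc.prems by (simp add: upath_def)
  then obtain a b where ab: "{a, b} \<in> E" "h a = p ! i" "h b = p ! Suc i"
    using HE_lift by blast
  have V: "a \<in> V" "b \<in> V" using edge_verts[OF ab(1)] by auto
  \<comment> \<open>Since \<open>i\<close> is not the last index, \<open>p ! i\<close> is the start
    or an internal vertex.\<close>
  have "hdeath (p ! i) \<le> t"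
  proof (cases i)
    case 0
    then show ?thesis using p t by (auto simp: upath_def hd_conv_nth)
  next
    case (Suc j)
    have j: "j < length (butlast (tl p))"
      using Suc Suc.prems by simp
    then have "butlast (tl p) ! j = p ! i"
      using Suc by (simp add: nth_butlast nth_tl)
    then show ?thesis
      using int nth_mem[OF j] by simp
  qed
  then have d: "death y \<le> t" "death a \<le> t"
    using hdeath_h y V ab by metis+
  have "near (R (Suc t)) 10 y a"
    using class_near_R[OF y(1) h_cong(1)[OF y(1) V(1)], of "Suc t"] y ab d t by simp
  then have "near (R (Suc t)) (15 * i + 10) x a"
    using near_trans[OF y(3)] by simp
  moreover have "near (R (Suc t)) 5 a b"
    using edge_near_after_death[OF ab(1), of "Suc t"] d t by simp
  ultimately have "near (R (Suc t)) (15 * Suc i) x b"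
    using near_trans[of "R (Suc t)" "15 * i + 10" x a 5 b] by simp
  then show ?case using V ab by blast
qed

lemma card_strongly_reachable:
  assumes v: "v \<in> h ` V"
  shows "card (strongly_reachable (h ` V, HE) HL r v) \<le> max 2 (g (15 * r) * (2 * Suc (g 5)))"
proof -
  obtain x where x: "x \<in> V" "h x = v" using v by auto
  let ?SR = "strongly_reachable (h ` V, HE) HL r v"
  define t where "t = hdeath v"
  have tm: "t \<le> m"
    unfolding t_def hdeath_def using death_le by simp
  show ?thesis
  proof (cases "t = m")
    case True
    have "?SR \<subseteq> code ` leader ` {y \<in> V. death y = m}"
    proof
      fix u assume u: "u \<in> ?SR"
      then obtain y where y: "y \<in> V" "u = h y"
        by (auto simp: strongly_reachable_def)
      have "m \<le> death y"
        using u HL_D[of u v] hdeath_h[OF y(1)] True y(2) unfolding t_def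
        by (simp add: strongly_reachable_def)
      then have "death y = m" using death_le[of y] by simp
      then show "u \<in> code ` leader ` {y \<in> V. death y = m}"
        using y by (auto simp: h_def)
    qed
    then have "card ?SR \<le> card (code ` leader ` {y \<in> V. death y = m})"
      by (rule card_mono[rotated]) (use finite_V in simp)
    also have "\<dots> \<le> card (leader ` {y \<in> V. death y = m})"
      by (rule card_image_le) (use finite_V in simp)
    also have "\<dots> \<le> 2" by (rule top_leaders)
    finally show ?thesis by simp
  next
    case False
    then have t: "t < m" using tm by simp
    let ?C = "c t ` {y \<in> V. near (R (Suc t)) (15 * r) x y}"
    have finC: "finite ?C" using finite_V by simp
    have fin: "finite (alive t q)" for q
      using finite_V by (simp add: alive_def)
    \<comment> \<open>The lifted walk ends in a part from \<open>?C\<close>, and the order makes its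
      end still alive at time \<open>t\<close>.\<close>
    have "?SR \<subseteq> code ` (\<Union>q\<in>?C. leader ` alive t q)"
    proof
      fix u assume u: "u \<in> ?SR"
      then obtain p where p: "upath (h ` V, HE) v p u" "length p - 1 \<le> r"
          "\<And>w. w \<in> set (butlast (tl p)) \<Longrightarrow> (v, w) \<in> HL" and uv: "(u, v) \<in> HL"
        by (auto simp: strongly_reachable_def)
      have p': "p \<noteq> []" "last p = u" using p(1) by (auto simp: upath_def)
      obtain y where y: "y \<in> V" "h y = p ! (length p - 1)"
          "near (R (Suc t)) (15 * (length p - 1)) x y"
        using path_lift[OF p(1) x, of t "length p - 1"] p(3) HL_D t p'(1)
        unfolding t_def by auto
      have hy: "h y = u" using y(2) p' by (simp add: last_conv_nth)
      have "near (R (Suc t)) (15 * r) x y"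
        using near_mono[OF y(3)] p(2) by simp
      then have "c t y \<in> ?C" using y(1) by blast
      moreover have "y \<in> alive t (c t y)"
        using HL_D[OF uv] hdeath_h[OF y(1)] hy y(1) by (simp add: alive_def t_def)
      ultimately show "u \<in> code ` (\<Union>q\<in>?C. leader ` alive t q)"
        using hy unfolding h_def by blast
    qed
    then have "card ?SR \<le> card (code ` (\<Union>q\<in>?C. leader ` alive t q))"
      by (rule card_mono[rotated]) (use finC fin in blast)
    also have "\<dots> \<le> card (\<Union>q\<in>?C. leader ` alive t q)"
      by (rule card_image_le) (use finC fin in blast)
    also have "\<dots> \<le> (\<Sum>q\<in>?C. card (leader ` alive t q))"
      by (rule card_UN_le[OF finC])
    also have "\<dots> \<le> (\<Sum>q\<in>?C. 2 * Suc (g 5))"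
      by (rule sum_mono) (rule alive_leaders[OF t])
    also have "\<dots> = card ?C * (2 * Suc (g 5))" by (simp only: sum_constant of_nat_id)
    also have "\<dots> \<le> g (15 * r) * (2 * Suc (g 5))"
      by (rule mult_right_mono[OF width[OF t x(1)]]) simp
    finally show ?thesis by simp
  qed
qed

lemma scol_le: "scol r (h ` V, HE) \<le> max 2 (g (15 * r) * (2 * Suc (g 5)))"
proof -
  have "scol r (h ` V, HE) \<le> (SUP v \<in> h ` V. card (strongly_reachable (h ` V, HE) HL r v))"
    unfolding scol_def by (rule cINF_lower2[of _ _ HL]) (use HL_linear in auto)
  also have "\<dots> \<le> max 2 (g (15 * r) * (2 * Suc (g 5)))"
  proof (cases "V = {}")
    case False
    then show ?thesis
      by (intro cSUP_least card_strongly_reachable) auto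
  qed simp
  finally show ?thesis .
qed

section \<open>The contraction as a quasi-isometry\<close>

lemma simple_graph_H: "simple_graph (h ` V, HE)"
  using finite_V HE_sub by (simp add: simple_graph_def)

text \<open>The map does not increase distances, and \<open>near_h_lift\<close> bounds the loss by
  \<open>13 * n + 12\<close>. Being onto, it reaches every vertex at distance 0.\<close>

lemma quasi_isometry_h: "quasi_isometry 13 12 (V, E) (h ` V, HE) h"
  unfolding quasi_isometry_def
proof (intro conjI ballI)
  fix x y assume "x \<in> uverts (V, E)" "y \<in> uverts (V, E)"
  then have V: "x \<in> V" "y \<in> V" "h x \<in> h ` V" by auto
  let ?d = "udist (V, E) x y" and ?e = "udist (h ` V, HE) (h x) (h y)"
  note le = udist_le_iff_near[OF E_V V(1)] udist_le_iff_near[OF HE_sub V(3)]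
  show "ereal (1 / 13) * ereal_of_enat ?d - ereal 12 \<le> ereal_of_enat ?e"
  proof (cases ?e)
    case (enat n)
    then have "?d \<le> enat (13 * n + 12)"
      using le near_h_lift[OF _ V(1,2)] by (metis order_refl)
    then obtain k where "?d = enat k" "k \<le> 13 * n + 12"
      by (cases ?d) auto
    then show ?thesis
      using enat by simp
  qed simp
  show "ereal_of_enat ?e \<le> ereal 13 * ereal_of_enat ?d + ereal 12"
  proof (cases ?d)
    case (enat n)
    then have "?e \<le> enat n"
      using le near_h by (metis order_refl)
    then obtain k where "?e = enat k" "k \<le> n"
      by (cases ?e) auto
    then show ?thesis
      using enat by simp
  qed simp
next
  fix n assume "n \<in> uverts (h ` V, HE)"
  then obtain x where x: "x \<in> V" "n = h x" by auto
  then have "udist (h ` V, HE) n (h x) \<le> enat 0"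
    using udist_le_iff_near[OF HE_sub] by simp
  then have "udist (h ` V, HE) n (h x) = 0" by (simp add: zero_enat_def[symmetric])
  then show "\<exists>x\<in>uverts (V, E). ereal_of_enat (udist (h ` V, HE) n (h x)) \<le> ereal 12"
    using x by (intro bexI[of _ x]) (auto simp: zero_enat_def)
qed auto

end

section \<open>Merge sequences\<close>

text \<open>For a partition the union has a single member, so no choice is involved.\<close>

definition part_of :: "'a set set \<Rightarrow> 'a \<Rightarrow> 'a set" where
  "part_of P x = \<Union>{A \<in> P. x \<in> A}"

lemma part_of_eq:
  assumes "partition_on V P" "A \<in> P" "x \<in> A"
  shows "part_of P x = A"
proof -
  have "{A \<in> P. x \<in> A} = {A}"
    using assms partition_onD2[OF assms(1)] by (auto simp: disjoint_def)
  then show ?thesis by (simp add: part_of_def)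
qed

lemma part_of_in:
  assumes "partition_on V P" "x \<in> V"
  shows "part_of P x \<in> P" "x \<in> part_of P x"
proof -
  obtain A where "A \<in> P" "x \<in> A"
    using assms partition_onD1[OF assms(1)] by auto
  then show "part_of P x \<in> P" "x \<in> part_of P x"
    using part_of_eq[OF assms(1)] by auto
qed

lemma merge_sequence_mono:
  assumes M: "merge_sequence G m P R" and st: "1 \<le> s" "s \<le> t" "t \<le> m"
  shows "R s \<subseteq> R t"
    and "x \<in> uverts G \<Longrightarrow> y \<in> uverts G \<Longrightarrow> part_of (P s) x = part_of (P s) y \<Longrightarrow>
      part_of (P t) x = part_of (P t) y"
proof -
  have one_step: "R i \<subseteq> R (Suc i)"
    "x \<in> uverts G \<Longrightarrow> y \<in> uverts G \<Longrightarrow> part_of (P i) x = part_of (P i) y \<Longrightarrow>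
      part_of (P (Suc i)) x = part_of (P (Suc i)) y" if i: "1 \<le> i" "i < m" for i
  proof -
    have ref: "refines (uverts G) (P i) (P (Suc i))" "R i \<subseteq> R (Suc i)"
      using M i by (auto simp: merge_sequence_def)
    show "R i \<subseteq> R (Suc i)" by (rule ref)
    assume xy: "x \<in> uverts G" "y \<in> uverts G" "part_of (P i) x = part_of (P i) y"
    have part: "partition_on (uverts G) (P i)" "partition_on (uverts G) (P (Suc i))"
      using ref(1) by (auto simp: refines_def)
    obtain Y where "Y \<in> P (Suc i)" "part_of (P i) x \<subseteq> Y"
      using ref(1) part_of_in(1)[OF part(1) xy(1)] by (auto simp: refines_def)
    then show "part_of (P (Suc i)) x = part_of (P (Suc i)) y"
      using part_of_eq[OF part(2)] part_of_in(2)[OF part(1)] xy by (metis subsetD)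
  qed
  show "R s \<subseteq> R t"
    using st(2,3,1)
  proof (induction rule: dec_induct)
    case (step n)
    then show ?case using one_step(1)[of n] by auto
  qed simp
  assume xy: "x \<in> uverts G" "y \<in> uverts G" "part_of (P s) x = part_of (P s) y"
  show "part_of (P t) x = part_of (P t) y"
    using st(2,3,1)
  proof (induction rule: dec_induct)
    case base
    then show ?case using xy by simp
  next
    case (step n)
    then show ?case
      using one_step(2)[of n] xy by auto
  qed
qed

text \<open>On \<open>nat\<close> a supremum bounds its family only if the family is bounded;
  finiteness ensures this.\<close>

lemma merge_width_of_ge:
  assumes "finite (uverts G)" "t \<in> {1..<m}" "v \<in> uverts G"
  shows "card (parts_meeting (uball (uverts G, R (Suc t)) r v) (P t)) \<le> merge_width_of G m P R r"
proof -
  let ?w = "\<lambda>t v. card (parts_meeting (uball (uverts G, R (Suc t)) r v) (P t))"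
  have "?w t v \<le> (SUP v \<in> uverts G. ?w t v)"
    by (rule cSUP_upper) (use assms in auto)
  also have "\<dots> \<le> (SUP t \<in> {1..<m}. SUP v \<in> uverts G. ?w t v)"
    by (rule cSUP_upper) (use assms in auto)
  finally show ?thesis unfolding merge_width_of_def .
qed

lemma merge_sequence_width:
  assumes G: "simple_graph G" and M: "merge_sequence G m P R"
    and f: "\<And>r. merge_width_of G m P R r \<le> f r" and t: "t < m" and v: "v \<in> uverts G"
  shows "card (part_of (P (max 1 t)) ` {u \<in> uverts G. near (R (max 1 (Suc t))) r v u})
    \<le> max 1 (f r)"
proof -
  let ?V = "uverts G" and ?t = "max 1 t"
  have fin: "finite ?V" using G by (simp add: simple_graph_def)
  have part: "partition_on ?V (P i)" "R i \<subseteq> nsets ?V 2" if "i \<in> {1..m}" for i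
    using M that by (auto simp: merge_sequence_def)
  have t': "?t \<in> {1..m}" using t by auto
  show ?thesis
  \<comment> \<open>For \<open>m = 1\<close> the width is an empty supremum and says nothing about
    the artificial time 0. There is only one part then, which explains \<open>max 1\<close>.\<close>
  proof (cases "m = 1")
    case True
    have "P m \<subseteq> {?V}"
      using M unfolding merge_sequence_def by blast
    moreover have "?t = m" using True t by simp
    ultimately have "P ?t \<subseteq> {?V}" by simp
    then have "part_of (P ?t) ` {u \<in> ?V. near (R (max 1 (Suc t))) r v u} \<subseteq> {?V}"
      using part_of_in(1)[OF part(1)[OF t']] by blast
    then have "card (part_of (P ?t) ` {u \<in> ?V. near (R (max 1 (Suc t))) r v u}) \<le> card {?V}"
      by (rule card_mono[rotated]) simp
    then show ?thesis by simp
  next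
    case False
    have mm: "?t \<in> {1..<m}"
      using t False by auto
    let ?pm = "parts_meeting (uball (?V, R (Suc ?t)) r v) (P ?t)"
    have "finite ?pm"
      using finite_elements[OF fin part(1)[OF t']] by (simp add: parts_meeting_def)
    moreover have "part_of (P ?t) ` {u \<in> ?V. near (R (max 1 (Suc t))) r v u} \<subseteq> ?pm"
    proof
      fix A assume "A \<in> part_of (P ?t) ` {u \<in> ?V. near (R (max 1 (Suc t))) r v u}"
      then obtain u where u: "A = part_of (P ?t) u" "u \<in> ?V" "near (R (max 1 (Suc t))) r v u"
        by blast
      \<comment> \<open>The two sides agree unless \<open>t = 0\<close>, where the claim reads
        \<open>R 1 \<subseteq> R 2\<close>.\<close>
      have "R (max 1 (Suc t)) \<subseteq> R (Suc ?t)"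
        by (rule merge_sequence_mono(1)[OF M]) (use mm in auto)
      then have "near (R (Suc ?t)) r v u"
        by (rule near_mono_edges[OF u(3)])
      moreover have "R (Suc ?t) \<subseteq> nsets ?V 2"
        by (rule part(2)) (use mm in auto)
      ultimately have "u \<in> uball (?V, R (Suc ?t)) r v"
        using udist_le_iff_near[OF _ v] u(2) by (simp add: uball_def)
      then show "A \<in> ?pm"
        using part_of_in[OF part(1)[OF t'] u(2)] u(1) by (auto simp: parts_meeting_def)
    qed
    ultimately have "card (part_of (P ?t) ` {u \<in> ?V. near (R (max 1 (Suc t))) r v u}) \<le> card ?pm"
      by (rule card_mono)
    also have "\<dots> \<le> f r"
      using merge_width_of_ge[OF fin mm v] f order_trans by blast
    finally show ?thesis by simp
  qed
qed

lemma merge_sequence_merge_data: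
  assumes G: "simple_graph G" and M: "merge_sequence G m P R"
    and f: "\<And>r. merge_width_of G m P R r \<le> f r"
  shows "merge_data (uverts G) (uedges G) m (\<lambda>t. part_of (P (max 1 t))) (\<lambda>t. R (max 1 t))
    (\<lambda>r. max 1 (f r))"
proof
  have m: "1 \<le> m" using M by (simp add: merge_sequence_def)
  have part: "partition_on (uverts G) (P i)" if "i \<in> {1..m}" for i
    using M that by (auto simp: merge_sequence_def)
  show "finite (uverts G)" "uedges G \<subseteq> nsets (uverts G) 2"
    using G by (auto simp: simple_graph_def)
  show "R (max 1 s) \<subseteq> R (max 1 t)" if "s \<le> t" "t \<le> m" for s t
    by (rule merge_sequence_mono(1)[OF M]) (use that m in auto)
  show "part_of (P (max 1 t)) x = part_of (P (max 1 t)) y"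
    if "s \<le> t" "t \<le> m" "x \<in> uverts G" "y \<in> uverts G"
      "part_of (P (max 1 s)) x = part_of (P (max 1 s)) y" for s t x y
    by (rule merge_sequence_mono(2)[OF M, of "max 1 s"]) (use that m in auto)
  show "x = y" if "x \<in> uverts G" "y \<in> uverts G"
      "part_of (P (max 1 0)) x = part_of (P (max 1 0)) y" for x y
  proof -
    have "part_of (P 1) z = {z}" if "z \<in> uverts G" for z
      using M that by (intro part_of_eq[OF part]) (auto simp: merge_sequence_def)
    then show ?thesis using that by simp
  qed
  show "part_of (P (max 1 m)) x = part_of (P (max 1 m)) y"
    if xy: "x \<in> uverts G" "y \<in> uverts G" for x y
  proof -
    have "P m \<subseteq> {uverts G}" using M by (auto simp: merge_sequence_def)
    moreover have "part_of (P m) x \<in> P m" "part_of (P m) y \<in> P m"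
      using part_of_in(1)[OF part] xy m by auto
    ultimately show ?thesis using m by (auto simp: max_def)
  qed
  show "{x', y'} \<in> uedges G"
    if t: "t \<le> m" and V: "x' \<in> uverts G" "y' \<in> uverts G"
      and eq: "part_of (P (max 1 t)) x = part_of (P (max 1 t)) x'"
        "part_of (P (max 1 t)) y = part_of (P (max 1 t)) y'"
      and e: "{x, y} \<in> uedges G" "{x, y} \<notin> R (max 1 t)"
      and ne: "x' \<noteq> y'" "{x', y'} \<notin> R (max 1 t)" for t x' y' x y
  proof -
    have t': "max 1 t \<in> {1..m}" using t m by auto
    have "x \<in> uverts G \<and> y \<in> uverts G \<and> x \<noteq> y"
      using nsets2_edge[OF _ e(1)] G by (auto simp: simple_graph_def)
    moreover have "homogeneous_modulo G (P (max 1 t)) (R (max 1 t))"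
      using M t' by (auto simp: merge_sequence_def)
    ultimately show ?thesis
      using part_of_in[OF part[OF t']] V eq e ne unfolding homogeneous_modulo_def by metis
  qed
  show "card (part_of (P (max 1 t)) ` {u \<in> uverts G. near (R (max 1 (Suc t))) r v u}) \<le> max 1 (f r)"
    if "t < m" "v \<in> uverts G" for t v r
    using merge_sequence_width[OF G M f] that by blast
qed

theorem theorem1p6:
  fixes C :: "'a ugraph set"
  assumes "\<forall>G\<in>C. simple_graph G"
    and "universally_bounded_merge_width C"
  shows "\<exists>D :: nat ugraph set.
    (\<forall>H\<in>D. simple_graph H) \<and> bounded_expansion D \<and>
    (\<forall>G\<in>C. \<exists>H\<in>D. quasi_isometric 13 12 G H)"
proof -
  obtain f where f: "\<And>G. G \<in> C \<Longrightarrow> \<exists>m P R. merge_sequence G m P R \<and>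
      (\<forall>r. merge_width_of G m P R r \<le> f r)"
    using assms(2) unfolding universally_bounded_merge_width_def by blast
  define g where "g = (\<lambda>r. max 1 (f r))"
  define N where "N = (\<lambda>r. max 2 (g (15 * r) * (2 * Suc (g 5))))"
  \<comment> \<open>Taking all graphs that obey the bounds makes bounded expansion immediate. It
    works because \<open>N\<close> depends on \<open>f\<close> alone and not on
    \<open>G\<close>.\<close>
  define D :: "nat ugraph set" where "D = {H. simple_graph H \<and> (\<forall>r. scol r H \<le> N r)}"
  have "\<exists>H\<in>D. quasi_isometric 13 12 G H" if "G \<in> C" for G
  proof -
    have G: "simple_graph G" using assms(1) that by blast
    obtain m P R where M: "merge_sequence G m P R" "\<And>r. merge_width_of G m P R r \<le> f r"
      using f[OF \<open>G \<in> C\<close>] by blast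
    have "finite (uverts G)" using G by (simp add: simple_graph_def)
    then obtain code :: "'a \<Rightarrow> nat" where code: "inj_on code (uverts G)"
      using finite_imp_inj_to_nat_seg by metis
    interpret merge_data "uverts G" "uedges G" m "\<lambda>t. part_of (P (max 1 t))" "\<lambda>t. R (max 1 t)" g
      unfolding g_def by (rule merge_sequence_merge_data[OF G M])
    interpret encoded_merge_data "uverts G" "uedges G" m "\<lambda>t. part_of (P (max 1 t))"
        "\<lambda>t. R (max 1 t)" g code
      by unfold_locales (rule code)
    have "(h ` uverts G, HE) \<in> D"
      using simple_graph_H scol_le unfolding D_def N_def by blast
    moreover have "quasi_isometric 13 12 G (h ` uverts G, HE)"
      using quasi_isometry_h unfolding quasi_isometric_def by auto
    ultimately show ?thesis by blast
  qed
  moreover have "bounded_expansion D"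
    unfolding bounded_expansion_def D_def by (auto intro!: bdd_aboveI)
  moreover have "\<forall>H\<in>D. simple_graph H"
    by (simp add: D_def)
  ultimately show ?thesis by blast
qed

end
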